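(* Let $g\ge1$, $n\ge3$, and let $A=(\alpha_1,\dots,\alpha_n)$ be positive integers with $\alpha_1\le\dots\le\alpha_n$ and $\sum_{i=1}^n 1/\alpha_i=1/g$. Put $F_k(A)=\dfrac{\alpha_1\cdots\alpha_n}{\mathrm{lcm}(\alpha_1,\dots,\alpha_n)^{n-k}}$. \begin{enumerate} \item $F_n(A)\le t_{g,n}^2/g$, with equality if and only if $A=(s_{g,1},\dots,s_{g,n-1},t_{g,n})$. \item If $(n,g)=(3,1)$, then $F_{2}(A)\le 9$ with equality iff $A=(3,3,3)$. Otherwise $F_{n-1}(A)\le 2t_{g,n-1}^2/g$, with equality if and only if $A$ is one of $(6,6,6)$, $(2,6,6,6)$, $(s_{g,1},\dots,s_{g,n-2},2t_{g,n-1},2t_{g,n-1})$. \item If $n=4$ and $g\in\{1,2\}$, then $F_2(A)\le 16g^2$ with equality iff $A=(4g,4g,4g,4g)$. If $(n,g)=(5,1)$, then $F_3(A)\le128$ with equality iff $A=(2,8,8,8,8)$. In all other cases $F_{n-2}(A)\le 3t_{g,n-2}^2/g$, with equality if and only if $A$ is one of $(12,12,12,12)$, $(s_{g,1},\dots,s_{g,n-3},3t_{g,n-2},3t_{g,n-2},3t_{g,n-2})$. \end{enumerate}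
   Context: Sylvester sequences: $s_{g,1}=g+1$, $s_{g,k+1}=s_{g,k}(s_{g,k}-1)+1$, and $t_{g,k}=s_{g,k}-1$. *)

theory Defs
  imports Complex_Main
begin

text \<open>Auxiliary 0-indexed Sylvester recursion: sylv0 g k = s_{g,k+1}.\<close>
primrec sylv0 :: "nat \<Rightarrow> nat \<Rightarrow> nat" where
  "sylv0 g 0 = g + 1"
| "sylv0 g (Suc k) = sylv0 g k * (sylv0 g k - 1) + 1"

text \<open>Sylvester sequence s_{g,k} (meaningful for k \<ge> 1) and t_{g,k} = s_{g,k} - 1.\<close>
definition sylv_s :: "nat \<Rightarrow> nat \<Rightarrow> nat" where
  "sylv_s g k = sylv0 g (k - 1)"

definition sylv_t :: "nat \<Rightarrow> nat \<Rightarrow> nat" where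
  "sylv_t g k = sylv_s g k - 1"

definition Fk :: "nat \<Rightarrow> nat list \<Rightarrow> real" where
  "Fk k A = real (prod_list A) / real (Lcm (set A)) ^ (length A - k)"

end

theory Submission
  imports Defs
begin

text \<open>
  Every \<alpha>_i divides the lcm, so F_k(A) is at most \<alpha>_1 ... \<alpha>_k, and it suffices to bound this product,
  i.e. to minimise x_1 ... x_k for x_i = 1/\<alpha>_i. Replacing x_(j+1), ..., x_n by their mean keeps the sum
  and does not increase the product of the first k entries as long as the last entry x_(j+1) absorbed is
  not too large compared with the mean of its successors. Absorbing as many entries as this allows
  stops at some j < k. The surviving entries x_1, ..., x_j are then compared with the Sylvester reciprocals
  1/s_i: by Curtiss' theorem the partial sums of the x_i are bounded by those of the 1/s_i, and summation
  by parts in the tangent estimate of the logarithm turns this into an inequality of products.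
  Hence F_k(A) is at most the value attained at
  (s_1, ..., s_j, (n - j) t_(j+1), ..., (n - j) t_(j+1)) for some j < k, with equality only there.
  For k = n one may take j = n - 1. For k = n - 1 and k = n - 2 these values increase with j up to
  j = k - 2, and the values at j = k - 2 and j = k - 1 compare like n - k + 1 and t_(k-1); the small
  Sylvester numbers are responsible for the exceptional cases.
\<close>

section \<open>Inequalities between products of reals\<close>

text \<open>Abel summation as an induction: the differences collected so far have nonnegative sum,
  so passing from the weight 1 / x_j to the larger 1 / x_(j+1) only raises the bound. The hypothesis
  stops one term short of the conclusion, so the full sum of \<open>y i - x i\<close> may be
  negative; Curtiss' theorem exploits this.\<close>

lemma sum_quotient_le_by_parts:
  fixes x y :: "nat \<Rightarrow> real"
  assumes "\<And>i. i \<le> j \<Longrightarrow> 0 < x i"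
    and "\<And>i. i < j \<Longrightarrow> x (Suc i) \<le> x i"
    and "\<And>i. i \<le> j \<Longrightarrow> (\<Sum>p<i. x p) \<le> (\<Sum>p<i. y p)"
  shows "(\<Sum>i<Suc j. (y i - x i) / x i) \<le> (\<Sum>i<Suc j. y i - x i) / x j"
  using assms
proof (induction j)
  case 0
  then show ?case by simp
next
  case (Suc j)
  let ?D = "\<Sum>i<Suc j. y i - x i"
  have "0 \<le> ?D"
    using Suc.prems(3)[of "Suc j"] by (simp add: sum_subtractf)
  then have "?D / x j \<le> ?D / x (Suc j)"
    using Suc.prems(1)[of j] Suc.prems(1)[of "Suc j"] Suc.prems(2)[of j]
    by (intro divide_left_mono) auto
  moreover have "(\<Sum>i<Suc j. (y i - x i) / x i) \<le> ?D / x j"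
    using Suc.prems by (intro Suc.IH) auto
  ultimately show ?case
    by (simp add: add_divide_distrib)
qed

text \<open>Sum the tangent estimate ln r \<le> r - 1 over the ratios r = y_i / x_i. Equal products
  force every gap to vanish, and ln r = r - 1 only at r = 1.\<close>

lemma prod_le_prod_of_sum_quotient:
  fixes x y :: "'a \<Rightarrow> real"
  assumes "finite I" and pos: "\<And>i. i \<in> I \<Longrightarrow> 0 < x i \<and> 0 < y i"
    and le: "(\<Sum>i\<in>I. (y i - x i) / x i) \<le> 0"
  shows "prod y I \<le> prod x I"
    and "prod y I = prod x I \<Longrightarrow> i \<in> I \<Longrightarrow> y i = x i"
proof -
  have quot: "(y i - x i) / x i = y i / x i - 1" if "i \<in> I" for i
    using pos[OF that] by (simp add: field_simps)
  have gap: "0 \<le> (y i / x i - 1) - ln (y i / x i)" if "i \<in> I" for i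
    using ln_le_minus_one[of "y i / x i"] pos[OF that] by simp
  have ln_prods: "ln (prod y I) - ln (prod x I) = (\<Sum>i\<in>I. ln (y i / x i))"
    using pos assms(1) by (simp add: ln_prod less_imp_neq[symmetric] ln_div sum_subtractf)
  have le': "(\<Sum>i\<in>I. y i / x i - 1) \<le> 0"
    using le quot by simp
  have ppos: "0 < prod x I" "0 < prod y I"
    using pos by (auto intro: prod_pos)
  have "(\<Sum>i\<in>I. ln (y i / x i)) \<le> (\<Sum>i\<in>I. y i / x i - 1)"
    using gap by (intro sum_mono) fastforce
  then have "ln (prod y I) \<le> ln (prod x I)"
    using le' ln_prods by linarith
  then show "prod y I \<le> prod x I"
    using ppos by simp
  assume eq: "prod y I = prod x I" and i: "i \<in> I"
  have "(\<Sum>i\<in>I. (y i / x i - 1) - ln (y i / x i)) \<le> 0"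
    using le' ln_prods eq by (simp only: sum_subtractf)
  then have "(\<Sum>i\<in>I. (y i / x i - 1) - ln (y i / x i)) = 0"
    using gap by (intro antisym sum_nonneg) auto
  then have "ln (y i / x i) = y i / x i - 1"
    using sum_nonneg_eq_0_iff[OF assms(1) gap] i by force
  then have "y i / x i = 1"
    using pos[OF i] by (intro ln_eq_minus_one) auto
  then show "y i = x i"
    using pos[OF i] by simp
qed

text \<open>
  With x = a (1 + (w + 1) d) the claim becomes (1 + d)^(l + 1) \<le> 1 + (w + 1) d; it follows from
  (1 - l d) (1 + d)^l \<le> 1, which is Bernoulli's inequality for 1 / (1 + d).
\<close>

lemma power_mean_le:
  fixes a x w :: real
  assumes a: "0 < a" "a \<le> x" and l: "1 \<le> l" "real l * x \<le> w * a"
  shows "((x + w * a) / (w + 1)) ^ Suc l \<le> x * a ^ l"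
    and "((x + w * a) / (w + 1)) ^ Suc l = x * a ^ l \<Longrightarrow> x = a"
proof -
  define d where "d = (x - a) / (a * (w + 1))"
  have "real l * a \<le> real l * x" using a by (simp add: mult_left_mono)
  then have "real l * a \<le> w * a" using l by linarith
  then have lw: "real l \<le> w" using a by simp
  have w: "1 \<le> w" using lw l by linarith
  have d0: "0 \<le> d" using a w by (simp add: d_def)
  have x: "x = a * (1 + (w + 1) * d)"
    using a w by (simp add: d_def) (simp add: field_simps)
  have mean: "(x + w * a) / (w + 1) = a * (1 + d)"
    using w unfolding x by (simp add: divide_simps) (simp add: algebra_simps)
  have "real l * (1 + (w + 1) * d) \<le> w"
    using l(2) a(1) unfolding x by (simp add: mult.left_commute mult.commute)
  then have cond: "real l * d * (w + 1) \<le> w - real l" by (simp add: algebra_simps)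
  have ld: "real l * d < 1"
  proof (rule ccontr)
    assume "\<not> ?thesis"
    then have "1 * (w + 1) \<le> real l * d * (w + 1)"
      using w by (intro mult_right_mono) auto
    from order_trans[OF this cond] show False by simp
  qed
  define e where "e = 1 / (1 + d)"
  have e: "0 < e" "e * (1 + d) = 1" using d0 by (simp_all add: e_def)
  have e1: "e - 1 = - (d * e)" using e(2) by (simp add: algebra_simps)
  have ed: "(1 - real l * (d * e)) * (1 + d) ^ l \<le> 1"
  proof -
    have "-1 \<le> e - 1" using e by simp
    then have "1 + real l * (e - 1) \<le> e ^ l"
      using Bernoulli_inequality[of "e - 1" l] by simp
    then have "1 - real l * (d * e) \<le> e ^ l" unfolding e1 by simp
    then have "(1 - real l * (d * e)) * (1 + d) ^ l \<le> e ^ l * (1 + d) ^ l"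
      using d0 by (intro mult_right_mono) auto
    also have "\<dots> = 1" unfolding power_mult_distrib[symmetric] e(2) by simp
    finally show ?thesis .
  qed
  have "0 \<le> d * e" using d0 e by simp
  then have e_le: "e \<le> 1" using e1 by linarith
  have "real l * (d * e) \<le> real l * d"
    using d0 e_le by (intro mult_left_mono mult_left_le) auto
  then have "(1 - real l * d) * (1 + d) ^ l \<le> (1 - real l * (d * e)) * (1 + d) ^ l"
    using d0 by (intro mult_right_mono) auto
  then have key: "(1 - real l * d) * (1 + d) ^ l \<le> 1" using ed by linarith
  \<comment> \<open>Multiplied out, the right side of \<open>fac\<close> exceeds 1 + d by d (w - l)
    - l d^2 (w + 1), which this makes nonnegative.\<close>
  have "d * (real l * d * (w + 1)) \<le> d * (w - real l)"
    using cond d0 by (intro mult_left_mono)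
  then have fac: "1 + d \<le> (1 - real l * d) * (1 + (w + 1) * d)"
    by (simp add: algebra_simps)
  have "(1 - real l * d) * (1 + d) ^ Suc l = (1 + d) * ((1 - real l * d) * (1 + d) ^ l)" by simp
  also have "\<dots> \<le> (1 + d) * 1" using key d0 by (intro mult_left_mono) auto
  finally have chain: "(1 - real l * d) * (1 + d) ^ Suc l \<le> 1 + d" by simp
  then have "(1 - real l * d) * (1 + d) ^ Suc l \<le> (1 - real l * d) * (1 + (w + 1) * d)"
    using fac by linarith
  then have main: "(1 + d) ^ Suc l \<le> 1 + (w + 1) * d"
    using ld by simp
  have lhs: "((x + w * a) / (w + 1)) ^ Suc l = a ^ Suc l * (1 + d) ^ Suc l"
    unfolding mean by (rule power_mult_distrib)
  have rhs: "x * a ^ l = a ^ Suc l * (1 + (w + 1) * d)" by (simp add: x)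
  show "((x + w * a) / (w + 1)) ^ Suc l \<le> x * a ^ l"
    unfolding lhs rhs using main a by (intro mult_left_mono) auto
  assume "((x + w * a) / (w + 1)) ^ Suc l = x * a ^ l"
  then have eq: "(1 + d) ^ Suc l = 1 + (w + 1) * d"
    unfolding lhs rhs using a by simp
  \<comment> \<open>For d > 0 also e < 1, so trading \<open>d * e\<close> for \<open>d\<close> in
    the chain is strict, which contradicts \<open>fac\<close>.\<close>
  have "d = 0"
  proof (rule ccontr)
    assume "d \<noteq> 0"
    then have dpos: "0 < d" using d0 by simp
    then have "0 < d * e" using e by simp
    then have "e < 1" using e1 by linarith
    then have "real l * (d * e) < real l * d"
      using l dpos by (intro mult_strict_left_mono) auto
    then have "(1 - real l * d) * (1 + d) ^ l < (1 - real l * (d * e)) * (1 + d) ^ l"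
      using d0 by (intro mult_strict_right_mono) auto
    then have "(1 - real l * d) * (1 + d) ^ l < 1" using ed by linarith
    then have "(1 + d) * ((1 - real l * d) * (1 + d) ^ l) < (1 + d) * 1"
      using d0 by (intro mult_strict_left_mono) auto
    then have "(1 - real l * d) * (1 + d) ^ Suc l < 1 + d" by (simp add: mult.left_commute)
    then show False using fac unfolding eq by linarith
  qed
  then show "x = a" using x by simp
qed

section \<open>Sylvester numbers\<close>

lemma sylv_t_1: "sylv_t g (Suc 0) = g"
  by (simp add: sylv_t_def sylv_s_def)

lemma sylv0_eq_sylv_t: "sylv0 g j = Suc (sylv_t g (Suc j))"
  by (cases j) (auto simp: sylv_t_def sylv_s_def)

lemma sylv_t_Suc: "sylv_t g (Suc (Suc j)) = sylv_t g (Suc j) * Suc (sylv_t g (Suc j))"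
  using sylv0_eq_sylv_t[of g "Suc j"] by (simp add: sylv0_eq_sylv_t[of g j])

lemma le_sylv_t: "g + j \<le> sylv_t g (Suc j)" if "1 \<le> g"
proof (induction j)
  case (Suc j)
  then have "1 * 1 \<le> sylv_t g (Suc j) * sylv_t g (Suc j)"
    using that by (intro mult_le_mono) linarith+
  then show ?case using Suc unfolding sylv_t_Suc mult_Suc_right by linarith
qed (simp add: sylv_t_1)

text \<open>The recursion t_(k+1) = t_k s_k telescopes down to t_1 = g. It also yields the
  divisibilities behind \<open>Lcm_level_list\<close>.\<close>

lemma prod_sylv0: "g * (\<Prod>i<j. sylv0 g i) = sylv_t g (Suc j)"
proof (induction j)
  case (Suc j)
  have "g * (\<Prod>i<Suc j. sylv0 g i) = g * (\<Prod>i<j. sylv0 g i) * sylv0 g j"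
    by (simp add: mult.assoc)
  then show ?case unfolding Suc.IH by (simp only: sylv_t_Suc sylv0_eq_sylv_t)
qed (simp add: sylv_t_1)

text \<open>Telescoping of 1 / (t + 1) = 1 / t - 1 / (t (t + 1)); thus 1 / t_(j+1) is what the first
  j Sylvester reciprocals leave of 1 / g.\<close>

lemma sum_inverse_sylv0:
  assumes "1 \<le> g"
  shows "(\<Sum>i<j. 1 / real (sylv0 g i)) = 1 / real g - 1 / real (sylv_t g (Suc j))"
proof (induction j)
  case (Suc j)
  have pos: "0 < real (sylv_t g (Suc j))" using le_sylv_t[OF assms, of j] assms by simp
  then have "1 / real (sylv0 g j)
      = 1 / real (sylv_t g (Suc j)) - 1 / real (sylv_t g (Suc (Suc j)))"
    by (simp add: sylv_t_Suc sylv0_eq_sylv_t divide_simps add_pos_nonneg[THEN less_imp_neq[THEN not_sym]])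
      (simp add: algebra_simps)
  then show ?case using Suc by simp
qed (simp add: sylv_t_1)

section \<open>Reciprocals of a solution and the means of their tails, indexed from 0\<close>

locale unit_fraction_sum =
  fixes g n :: nat and \<alpha> :: "nat \<Rightarrow> nat"
  assumes g_ge_1: "1 \<le> g"
    and \<alpha>_pos: "i < n \<Longrightarrow> 0 < \<alpha> i"
    and \<alpha>_mono: "i \<le> j \<Longrightarrow> j < n \<Longrightarrow> \<alpha> i \<le> \<alpha> j"
    and total: "(\<Sum>i<n. 1 / real (\<alpha> i)) = 1 / real g"
begin

definition x :: "nat \<Rightarrow> real" where
  "x i = 1 / real (\<alpha> i)"

text \<open>The mean of x_j, ..., x_(n-1), written through the known total so that it compares
  directly with partial sums of Sylvester reciprocals; \<open>rest_eq_sum\<close> recovers the tail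
  sum.\<close>

definition avg :: "nat \<Rightarrow> real" where
  "avg j = (1 / real g - (\<Sum>i<j. x i)) / real (n - j)"

lemma x_pos: "i < n \<Longrightarrow> 0 < x i"
  using \<alpha>_pos by (simp add: x_def)

lemma x_antimono: "i \<le> j \<Longrightarrow> j < n \<Longrightarrow> x j \<le> x i"
  using \<alpha>_mono[of i j] \<alpha>_pos[of i] \<alpha>_pos[of j] by (simp add: x_def frac_le)

lemma avg_eq: "j < n \<Longrightarrow> real (n - j) * avg j = 1 / real g - (\<Sum>i<j. x i)"
  by (simp add: avg_def)

lemma rest_eq_sum: "j \<le> n \<Longrightarrow> 1 / real g - (\<Sum>i<j. x i) = (\<Sum>i = j..<n. x i)"
  using sum.atLeastLessThan_concat[of 0 j n x] total
  by (simp add: lessThan_atLeast0 x_def)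

lemma avg_pos: "j < n \<Longrightarrow> 0 < avg j"
  unfolding avg_def using rest_eq_sum[of j] x_pos
  by (auto intro!: divide_pos_pos sum_pos)

lemma avg_le: "avg j \<le> x j" if "j < n"
proof -
  have "(\<Sum>i = j..<n. x i) \<le> of_nat (card {j..<n}) * x j"
    using x_antimono by (intro sum_bounded_above) auto
  then show ?thesis
    unfolding avg_def using rest_eq_sum[of j] that by (simp add: field_simps)
qed

text \<open>The deviations x_j - x_i are nonnegative and sum to zero. The equality cases of the
  levelling below rest on this.\<close>

lemma avg_eq_nthD: "x i = avg j" if "avg j = x j" "j \<le> i" "i < n"
proof -
  have "(\<Sum>i = j..<n. x i) = real (n - j) * x j"
    using avg_eq[of j] rest_eq_sum[of j] that by simp
  then have "(\<Sum>i = j..<n. x j - x i) = 0"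
    by (simp add: sum_subtractf)
  then have "\<forall>i\<in>{j..<n}. x j - x i = 0"
    using x_antimono by (subst (asm) sum_nonneg_eq_0_iff) auto
  then have "x j - x i = 0"
    using that by (simp del: right_minus_eq)
  then show ?thesis using that by simp
qed

lemma avg_rec:
  assumes "Suc j < n"
  shows "avg j = (x j + real (n - Suc j) * avg (Suc j)) / (real (n - Suc j) + 1)"
proof -
  have "real (n - j) = real (n - Suc j) + 1" using assms by simp
  then show ?thesis
    using avg_eq[OF assms] by (simp add: avg_def[of j] algebra_simps)
qed

lemma prod_mult_sum_Ints:
  "(\<Prod>i<j. real (\<alpha> i)) * (\<Sum>i<j. x i) \<in> \<int>" if "j \<le> n"
  using that
proof (induction j)
  case (Suc j)
  have "(\<Prod>i<Suc j. real (\<alpha> i)) * (\<Sum>i<Suc j. x i)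
      = real (\<alpha> j) * ((\<Prod>i<j. real (\<alpha> i)) * (\<Sum>i<j. x i)) + real (\<Prod>i<j. \<alpha> i)"
    using \<alpha>_pos[of j] Suc.prems by (simp add: x_def algebra_simps)
  also have "\<dots> \<in> \<int>"
    by (rule Ints_add[OF Ints_mult[OF Ints_of_nat Suc.IH] Ints_of_nat]) (use Suc.prems in simp)
  finally show ?case .
qed simp

text \<open>The remainder is positive and becomes an integer when multiplied by g \<alpha>_1 ...
  \<alpha>_j, so that integer is at least 1. Sylvester numbers attain equality.\<close>

lemma rest_ge_prod:
  assumes "j < n"
  shows "(\<Prod>i<j. x i) / real g \<le> 1 / real g - (\<Sum>i<j. x i)"
proof -
  define P where "P = (\<Prod>i<j. real (\<alpha> i))"
  define r where "r = 1 / real g - (\<Sum>i<j. x i)"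
  have P: "0 < P" unfolding P_def using \<alpha>_pos assms by (intro prod_pos) auto
  have Px: "P * (\<Prod>i<j. x i) = 1"
    unfolding P_def x_def prod.distrib[symmetric] using \<alpha>_pos assms by (intro prod.neutral) auto
  have r: "0 < r" using avg_pos[OF assms] assms by (simp add: avg_def r_def zero_less_divide_iff)
  have "real g * P * r = P - real g * (P * (\<Sum>i<j. x i))"
    using g_ge_1 by (simp add: r_def algebra_simps)
  moreover have "P \<in> \<int>" unfolding P_def by (intro Ints_prod) auto
  ultimately have "real g * P * r \<in> \<int>"
    using prod_mult_sum_Ints[of j] assms by (auto simp: P_def)
  moreover have "0 < real g * P * r" using P r g_ge_1 by simp
  ultimately have "1 \<le> real g * P * r" by (auto elim!: Ints_cases)
  then have "(P * (\<Prod>i<j. x i)) / (real g * P) \<le> r"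
    using P g_ge_1 unfolding Px by (simp add: field_simps)
  then show ?thesis using P by (simp add: r_def)
qed

section \<open>Comparison with the Sylvester reciprocals\<close>

definition y :: "nat \<Rightarrow> real" where
  "y i = 1 / real (sylv0 g i)"

lemma y_pos: "0 < y i"
  by (simp add: y_def sylv0_eq_sylv_t)

lemma t_pos: "0 < real (sylv_t g (Suc j))"
  using le_sylv_t[OF g_ge_1, of j] g_ge_1 by simp

lemma sum_y: "(\<Sum>i<j. y i) = 1 / real g - 1 / real (sylv_t g (Suc j))"
  unfolding y_def by (rule sum_inverse_sylv0[OF g_ge_1])

lemma prod_y: "(\<Prod>i<j. y i) = real g / real (sylv_t g (Suc j))"
proof -
  have "(\<Prod>i<j. real (sylv0 g i)) \<noteq> 0" by (simp add: sylv0_eq_sylv_t)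
  then show ?thesis
    unfolding prod_sylv0[symmetric] using g_ge_1 by (simp add: y_def prod_dividef)
qed

text \<open>Curtiss' theorem; the argument is Soundararajan's.\<close>

lemma sum_le_sylvester: "(\<Sum>i<j. x i) \<le> (\<Sum>i<j. y i)" if "j < n"
  using that
proof (induction j rule: less_induct)
  case (less j)
  show ?case
  proof (cases j)
    case (Suc m)
    show ?thesis
    proof (rule ccontr)
      \<comment> \<open>Shorter partial sums are ordered by induction and the full difference is
        negative, so the product of the y_i is at most that of the x_i. By
        \<open>rest_ge_prod\<close> the x_i then leave a remainder of at least 1 / t_(j+1), which is
        what the y_i leave, against \<open>neg\<close>.\<close>
      assume neg: "\<not> ?thesis"
      have "(\<Sum>i<j. (y i - x i) / x i) \<le> (\<Sum>i<j. y i - x i) / x m"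
        unfolding Suc using less Suc x_pos x_antimono by (intro sum_quotient_le_by_parts) auto
      also have "\<dots> \<le> 0"
        using neg x_pos[of m] less.prems Suc
        by (intro divide_nonpos_pos) (auto simp: sum_subtractf)
      finally have "(\<Prod>i<j. y i) \<le> (\<Prod>i<j. x i)"
        using x_pos y_pos less.prems by (intro prod_le_prod_of_sum_quotient) auto
      then have "1 / real (sylv_t g (Suc j)) \<le> (\<Prod>i<j. x i) / real g"
        using g_ge_1 by (simp add: prod_y field_simps)
      then show False using rest_ge_prod[OF less.prems] neg sum_y[of j] by linarith
    qed
  qed simp
qed

section \<open>Levelling the tail\<close>

definition levelled :: "nat \<Rightarrow> nat \<Rightarrow> real" where
  "levelled k j = (\<Prod>i<j. x i) * avg j ^ (k - j)"

text \<open>Inequality and equality case are bundled so that the descent in j carries both.\<close>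

definition level_bound :: "nat \<Rightarrow> nat \<Rightarrow> bool" where
  "level_bound k j \<longleftrightarrow> levelled k j \<le> (\<Prod>i<k. x i) \<and>
     (levelled k j = (\<Prod>i<k. x i) \<longrightarrow> (\<forall>i\<in>{j..<n}. x i = avg j))"

text \<open>Start of the descent: of the first j + 1 factors only x_j changes, and it is at least
  the mean of the tail it heads.\<close>

lemma level_bound_last: "level_bound (Suc j) j" if "j < n"
proof -
  have P: "0 < (\<Prod>i<j. x i)" using x_pos that by (intro prod_pos) auto
  have lev: "levelled (Suc j) j = (\<Prod>i<j. x i) * avg j" by (simp add: levelled_def)
  have "(\<Prod>i<j. x i) * avg j \<le> (\<Prod>i<j. x i) * x j"
    using avg_le[OF that] P by (intro mult_left_mono) auto
  moreover have "x i = avg j"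
    if eq: "(\<Prod>i<j. x i) * avg j = (\<Prod>i<j. x i) * x j" and i: "j \<le> i" "i < n" for i
  proof -
    have "avg j = x j"
      using eq mult_left_cancel[of "\<Prod>i<j. x i"] P by (metis less_irrefl)
    then show ?thesis using i by (rule avg_eq_nthD)
  qed
  ultimately show ?thesis
    unfolding level_bound_def lev prod.lessThan_Suc atLeastLessThan_iff Ball_def by blast
qed

text \<open>Absorbs x_j into the levelled tail by \<open>power_mean_le\<close> with a the mean of
  the later entries, w their number and l the number of them among the first k; \<open>cond\<close>
  is its hypothesis. Equality gives x_j = a, so the mean of the longer tail equals its first
  entry.\<close>

lemma level_bound_step:
  assumes "Suc j < k" "k \<le> n" and "level_bound k (Suc j)"
    and cond: "real (k - Suc j) * x j \<le> real (n - Suc j) * avg (Suc j)"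
  shows "level_bound k j"
proof -
  have n: "Suc j < n" using assms by linarith
  have kj: "k - j = Suc (k - Suc j)" using assms by simp
  have P: "0 < (\<Prod>i<j. x i)" using x_pos n by (intro prod_pos) auto
  have le: "avg (Suc j) \<le> x j"
    using avg_le[OF n] x_antimono[of j "Suc j"] n by simp
  have l: "1 \<le> k - Suc j" using assms by simp
  note pm = power_mean_le[OF avg_pos[OF n] le l cond, folded avg_rec[OF n]]
  have j1: "levelled k j = (\<Prod>i<j. x i) * avg j ^ Suc (k - Suc j)"
    by (simp add: levelled_def kj)
  have j2: "levelled k (Suc j) = (\<Prod>i<j. x i) * (x j * avg (Suc j) ^ (k - Suc j))"
    by (simp add: levelled_def)
  have lev: "levelled k j \<le> levelled k (Suc j)"
    unfolding j1 j2 using pm(1) P by (intro mult_left_mono) auto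
  have nxt: "levelled k (Suc j) \<le> (\<Prod>i<k. x i)"
    using assms(3) by (simp add: level_bound_def)
  have "x i = avg j" if eq: "levelled k j = (\<Prod>i<k. x i)" and i: "j \<le> i" "i < n" for i
  proof -
    have "levelled k j = levelled k (Suc j)" using eq lev nxt by linarith
    then have "avg j ^ Suc (k - Suc j) = x j * avg (Suc j) ^ (k - Suc j)"
      using mult_left_cancel[of "\<Prod>i<j. x i"] P unfolding j1 j2 by (metis less_irrefl)
    then have xj: "x j = avg (Suc j)" by (rule pm(2))
    then have "avg j = x j"
      unfolding avg_rec[OF n] by (simp add: field_simps)
    then show ?thesis using i by (rule avg_eq_nthD)
  qed
  then show ?thesis using lev nxt by (auto simp: level_bound_def)
qed

text \<open>
  The inequality is what the tangent estimate in \<open>prod_x_ge\<close> needs; if it fails,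
  \<open>level_bound_step\<close> leads from j to j - 1.
\<close>

definition extremal :: "nat \<Rightarrow> nat \<Rightarrow> bool" where
  "extremal k j \<longleftrightarrow> level_bound k j \<and>
     (j = 0 \<or> real (n - j) * avg j \<le> real (k - j) * x (j - 1))"

text \<open>Take the least j with \<open>level_bound k j\<close>: if the inequality failed there,
  one more step would contradict minimality.\<close>

lemma ex_extremal:
  assumes "0 < k" "k \<le> n"
  shows "\<exists>j<k. extremal k j"
proof -
  define j where "j = (LEAST j. level_bound k j)"
  have ex: "level_bound k (k - 1)"
    using level_bound_last[of "k - 1"] assms by simp
  have j: "level_bound k j" unfolding j_def using ex by (rule LeastI)
  have jk: "j \<le> k - 1" unfolding j_def using ex by (rule Least_le)
  have "real (n - j) * avg j \<le> real (k - j) * x i" if i: "j = Suc i" for i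
  proof (rule ccontr)
    assume neg: "\<not> ?thesis"
    have "level_bound k i"
    proof (rule level_bound_step)
      show "Suc i < k" using i jk assms by linarith
      show "real (k - Suc i) * x i \<le> real (n - Suc i) * avg (Suc i)" using neg i by simp
    qed (use i j assms in simp_all)
    then have "j \<le> i" unfolding j_def by (rule Least_le)
    then show False using i by simp
  qed
  then have "extremal k j" using j by (cases j) (simp_all add: extremal_def)
  moreover have "j < k" using jk assms by linarith
  ultimately show ?thesis by blast
qed

text \<open>For k = n both factors n - j and k - j are 1 at j = n - 1, so monotonicity suffices and
  the level is known in advance.\<close>

lemma extremal_full: "extremal n (n - 1)" if "0 < n"
proof -
  have "avg (n - 1) \<le> x (n - 1 - 1)"
    using avg_le[of "n - 1"] x_antimono[of "n - 1 - 1" "n - 1"] that by force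
  then show ?thesis
    using level_bound_last[of "n - 1"] that by (simp add: extremal_def)
qed

section \<open>Product bounds at an extremal level\<close>

text \<open>The number b spreads the remainder 1 / t_(j+1) of the Sylvester reciprocals evenly over
  n - j entries. The levelled sequence u is compared with the Sylvester sequence v by the tangent
  estimate.\<close>

lemma prod_x_ge:
  assumes "extremal k j" "j < k" "k \<le> n"
  defines "b \<equiv> 1 / (real (n - j) * real (sylv_t g (Suc j)))"
  shows "(\<Prod>i<j. y i) * b ^ (k - j) \<le> (\<Prod>i<k. x i)"
    and "(\<Prod>i<j. y i) * b ^ (k - j) = (\<Prod>i<k. x i) \<Longrightarrow> i < n \<Longrightarrow> x i = (if i < j then y i else b)"
proof -
  have jn: "j < n" using assms by simp
  have b: "0 < b" using jn t_pos by (simp add: b_def)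
  define u where "u i = (if i < j then x i else avg j)" for i
  define v where "v i = (if i < j then y i else b)" for i
  have split: "{..<k} = {..<j} \<union> {j..<k}" "{..<j} \<inter> {j..<k} = {}"
    using assms by auto
  have pu: "(\<Prod>i<k. u i) = levelled k j"
    unfolding split(1) by (subst prod.union_disjoint) (auto simp: u_def levelled_def)
  have pv: "(\<Prod>i<k. v i) = (\<Prod>i<j. y i) * b ^ (k - j)"
    unfolding split(1) by (subst prod.union_disjoint) (auto simp: v_def)
  \<comment> \<open>The amount by which the Sylvester head exceeds the given one; the tail of v
    loses the same amount, spread over n - j entries of which k - j are counted.\<close>
  define D where "D = (\<Sum>i<j. y i - x i)"
  have D: "0 \<le> D" using sum_le_sylvester[OF jn] by (simp add: D_def sum_subtractf)
  have ba: "real (n - j) * (b - avg j) = - D"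
  proof -
    have "real (n - j) * b = 1 / real g - (\<Sum>i<j. y i)"
      using jn by (simp add: b_def sum_y)
    then show ?thesis using avg_eq[OF jn] by (simp add: D_def sum_subtractf algebra_simps)
  qed
  have head: "(\<Sum>i<j. (y i - x i) / x i) \<le> real (k - j) * D / (real (n - j) * avg j)"
  proof (cases j)
    case (Suc m)
    have "(\<Sum>i<j. (y i - x i) / x i) \<le> D / x m"
      unfolding Suc D_def using jn Suc sum_le_sylvester x_pos x_antimono
      by (intro sum_quotient_le_by_parts) auto
    also have "\<dots> \<le> real (k - j) * D / (real (n - j) * avg j)"
    proof -
      \<comment> \<open>Extremality turns the bound D / x_m for the head into the exact size of the
        loss in the tail, so the two cancel.\<close>
      have "real (n - j) * avg j \<le> real (k - j) * x m"
        using assms(1) Suc by (simp add: extremal_def)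
      then have "(real (n - j) * avg j) * D \<le> (real (k - j) * x m) * D"
        using D by (rule mult_right_mono)
      moreover have "0 < real (n - j) * avg j" using avg_pos[OF jn] jn by simp
      ultimately show ?thesis using x_pos[of m] jn Suc by (simp add: divide_simps mult_ac)
    qed
    finally show ?thesis .
  qed (simp add: D_def)
  have "(\<Sum>i<k. (v i - u i) / u i)
      = (\<Sum>i<j. (y i - x i) / x i) + real (k - j) * ((b - avg j) / avg j)"
    unfolding split(1) by (subst sum.union_disjoint) (auto simp: u_def v_def)
  moreover have "(b - avg j) / avg j = - D / (real (n - j) * avg j)"
    unfolding ba[symmetric] using jn by simp
  ultimately have "(\<Sum>i<k. (v i - u i) / u i) \<le> 0" using head by simp
  note cmp = prod_le_prod_of_sum_quotient[OF _ _ this]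
  have pos: "0 < u i \<and> 0 < v i" if "i \<in> {..<k}" for i
    using x_pos y_pos avg_pos[OF jn] b jn that by (simp add: u_def v_def)
  have lev: "levelled k j \<le> (\<Prod>i<k. x i)"
    using assms(1) by (simp add: extremal_def level_bound_def)
  have le: "(\<Prod>i<j. y i) * b ^ (k - j) \<le> levelled k j"
    using cmp(1) pos unfolding pu pv by simp
  show "(\<Prod>i<j. y i) * b ^ (k - j) \<le> (\<Prod>i<k. x i)" using le lev by linarith
  assume eq: "(\<Prod>i<j. y i) * b ^ (k - j) = (\<Prod>i<k. x i)" and i: "i < n"
  have eqs: "(\<Prod>i<k. v i) = (\<Prod>i<k. u i)" "levelled k j = (\<Prod>i<k. x i)"
    using le lev eq unfolding pu pv by linarith+
  have uv: "v p = u p" if "p < k" for p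
    using cmp(2)[OF _ _ eqs(1)] pos that by simp
  have "avg j = b" using uv[of j] assms(2) by (simp add: u_def v_def)
  moreover have "x i = avg j" if "\<not> i < j"
    using assms(1) eqs(2) i that by (simp add: extremal_def level_bound_def)
  moreover have "x i = y i" if "i < j"
    using uv[of i] that assms(2) by (simp add: u_def v_def)
  ultimately show "x i = (if i < j then y i else b)" by simp
qed

lemma prod_\<alpha>_le:
  assumes "extremal k j" "j < k" "k \<le> n"
  defines "c \<equiv> (n - j) * sylv_t g (Suc j)"
  shows "(\<Prod>i<k. real (\<alpha> i)) \<le> real (sylv_t g (Suc j) * c ^ (k - j)) / real g"
    and "(\<Prod>i<k. real (\<alpha> i)) = real (sylv_t g (Suc j) * c ^ (k - j)) / real g \<Longrightarrow>
      i < n \<Longrightarrow> \<alpha> i = (if i < j then sylv0 g i else c)"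
proof -
  let ?B = "real (sylv_t g (Suc j) * c ^ (k - j)) / real g"
  have c: "0 < real c" using t_pos[of j] assms by (simp add: c_def)
  have B: "(\<Prod>i<j. y i) * (1 / real c) ^ (k - j) = 1 / ?B"
    by (simp add: prod_y power_one_over)
  have Bpos: "0 < ?B" using c t_pos[of j] g_ge_1 by simp
  have P: "(\<Prod>i<k. x i) = 1 / (\<Prod>i<k. real (\<alpha> i))"
    by (simp add: x_def prod_dividef)
  have Ppos: "0 < (\<Prod>i<k. real (\<alpha> i))"
    using \<alpha>_pos assms by (intro prod_pos) auto
  have bc: "1 / (real (n - j) * real (sylv_t g (Suc j))) = 1 / real c" by (simp add: c_def)
  note ge = prod_x_ge[OF assms(1-3), unfolded bc B P]
  show "(\<Prod>i<k. real (\<alpha> i)) \<le> ?B"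
    using ge(1) Ppos Bpos by (simp add: divide_simps mult.commute split: if_splits)
  assume "(\<Prod>i<k. real (\<alpha> i)) = ?B" and i: "i < n"
  then have "x i = (if i < j then y i else 1 / real c)" using ge(2) by simp
  then show "\<alpha> i = (if i < j then sylv0 g i else c)"
    by (simp add: x_def y_def split: if_splits)
qed

end

section \<open>The candidate lists and their values\<close>

definition level_list :: "nat \<Rightarrow> nat \<Rightarrow> nat \<Rightarrow> nat list" where
  "level_list g n j = map (sylv_s g) [1..<Suc j] @ replicate (n - j) ((n - j) * sylv_t g (Suc j))"

text \<open>This is g times F_k of \<open>level_list g n j\<close> when j < k (see
  \<open>Fk_level_list\<close>); clearing g keeps the comparison of levels within the
  naturals.\<close>

definition level_value :: "nat \<Rightarrow> nat \<Rightarrow> nat \<Rightarrow> nat \<Rightarrow> nat" where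
  "level_value g n k j = sylv_t g (Suc j) * ((n - j) * sylv_t g (Suc j)) ^ (k - j)"

lemma prod_list_nth: "prod_list xs = (\<Prod>i<length xs. xs ! i)"
  for xs :: "'a::comm_monoid_mult list"
  by (induction xs) (simp_all add: prod.lessThan_Suc_shift del: prod.lessThan_Suc)

lemma length_level_list: "j \<le> n \<Longrightarrow> length (level_list g n j) = n"
  by (simp add: level_list_def del: upt_Suc)

lemma nth_level_list:
  "i < n \<Longrightarrow> level_list g n j ! i = (if i < j then sylv0 g i else (n - j) * sylv_t g (Suc j))"
  by (auto simp: level_list_def nth_append sylv_s_def simp del: upt_Suc)

lemma prod_list_level_list:
  "g * prod_list (level_list g n j) = sylv_t g (Suc j) * ((n - j) * sylv_t g (Suc j)) ^ (n - j)"
proof -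
  have "prod_list (map (sylv_s g) [1..<Suc j]) = (\<Prod>i<j. sylv0 g i)"
    by (simp add: prod_list_nth sylv_s_def del: upt_Suc)
  then have "g * prod_list (level_list g n j)
      = (g * (\<Prod>i<j. sylv0 g i)) * ((n - j) * sylv_t g (Suc j)) ^ (n - j)"
    by (simp add: level_list_def mult.assoc del: upt_Suc)
  then show ?thesis unfolding prod_sylv0 .
qed

text \<open>The repeated entry is itself a common multiple, since each s_i with i \<le> j divides
  t_(j+1) by \<open>prod_sylv0\<close>.\<close>

lemma Lcm_level_list:
  assumes "j < n"
  shows "Lcm (set (level_list g n j)) = (n - j) * sylv_t g (Suc j)"
proof -
  let ?c = "(n - j) * sylv_t g (Suc j)"
  have "a dvd ?c" if a: "a \<in> set (level_list g n j)" for a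
  proof -
    obtain i where i: "i < n" "a = level_list g n j ! i"
      using a assms by (auto simp: in_set_conv_nth length_level_list)
    have "sylv0 g i dvd sylv_t g (Suc j)" if "i < j"
      unfolding prod_sylv0[of g j, symmetric] using that by (intro dvd_mult dvd_prodI) auto
    then show ?thesis using i by (simp add: nth_level_list)
  qed
  moreover have "?c \<in> set (level_list g n j)" using assms by (simp add: level_list_def)
  ultimately show ?thesis by (intro dvd_antisym Lcm_least dvd_Lcm)
qed

lemma Fk_level_list:
  assumes "1 \<le> g" "j < k" "k \<le> n"
  shows "Fk k (level_list g n j) = real (level_value g n k j) / real g"
proof -
  let ?c = "(n - j) * sylv_t g (Suc j)"
  have c: "0 < real ?c" using le_sylv_t[OF assms(1), of j] assms by simp
  have "n - j = (k - j) + (n - k)" using assms by simp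
  then have "?c ^ (n - j) = ?c ^ (k - j) * ?c ^ (n - k)"
    by (metis power_add)
  then have "real g * real (prod_list (level_list g n j))
      = real (level_value g n k j) * real ?c ^ (n - k)"
    unfolding of_nat_mult[symmetric] prod_list_level_list
    by (simp only: level_value_def of_nat_mult of_nat_power mult.assoc)
  then have "real (prod_list (level_list g n j))
      = real (level_value g n k j) * real ?c ^ (n - k) / real g"
    using assms(1) by (simp add: field_simps)
  moreover have "length (level_list g n j) = n" "Lcm (set (level_list g n j)) = ?c"
    using assms by (simp_all add: length_level_list Lcm_level_list)
  ultimately show ?thesis
    unfolding Fk_def using c by (simp del: of_nat_mult)
qed

section \<open>From products to F_k\<close>

lemma Fk_le_prod:
  assumes pos: "\<forall>a\<in>set A. 0 < a" and k: "k \<le> length A"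
  shows "Fk k A \<le> (\<Prod>i<k. real (A ! i))"
proof -
  let ?n = "length A" and ?L = "real (Lcm (set A))"
  have L: "0 < Lcm (set A)" using pos by (auto intro!: Nat.gr0I simp: Lcm_0_iff)
  have le: "real (A ! i) \<le> ?L" if "i < ?n" for i
    using that L by (auto intro!: dvd_imp_le dvd_Lcm)
  have "real (prod_list A) = (\<Prod>i<?n. real (A ! i))"
    by (simp add: prod_list_nth)
  also have "\<dots> = (\<Prod>i<k. real (A ! i)) * (\<Prod>i = k..<?n. real (A ! i))"
    using k by (simp add: lessThan_atLeast0 prod.atLeastLessThan_concat)
  also have "\<dots> \<le> (\<Prod>i<k. real (A ! i)) * (\<Prod>i = k..<?n. ?L)"
    using le by (intro mult_left_mono prod_mono prod_nonneg) auto
  finally show ?thesis using L by (simp add: Fk_def field_simps)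
qed

text \<open>The level j depends on A, so bounds with k < n still require a comparison of levels; for
  k = n it is pinned to n - 1.\<close>

lemma Fk_le_level_value:
  fixes g n :: nat and A :: "nat list"
  assumes "1 \<le> g" "length A = n" "\<forall>a\<in>set A. a > 0" "sorted A"
    and "(\<Sum>a\<leftarrow>A. 1 / real a) = 1 / real g" "1 \<le> k" "k \<le> n"
  shows "\<exists>j<k. (k = n \<longrightarrow> j = n - 1) \<and> Fk k A \<le> real (level_value g n k j) / real g \<and>
      (Fk k A = real (level_value g n k j) / real g \<longrightarrow> A = level_list g n j)"
proof -
  interpret unit_fraction_sum g n "(!) A"
    using assms by unfold_locales (auto simp: sorted_nth_mono sum_list_sum_nth lessThan_atLeast0)
  obtain j where j: "j < k" "extremal k j" "k = n \<longrightarrow> j = n - 1"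
  proof (cases "k = n")
    case True
    then show ?thesis using extremal_full that[of "n - 1"] assms(6) by auto
  next
    case False
    then show ?thesis using ex_extremal[of k] assms(6,7) that by auto
  qed
  have le: "(\<Prod>i<k. real (A ! i)) \<le> real (level_value g n k j) / real g"
    using prod_\<alpha>_le(1)[OF j(2,1) assms(7)] by (simp only: level_value_def)
  have F: "Fk k A \<le> (\<Prod>i<k. real (A ! i))"
    using Fk_le_prod assms by simp
  have "A = level_list g n j" if eq: "Fk k A = real (level_value g n k j) / real g"
  proof (rule nth_equalityI)
    show "length A = length (level_list g n j)"
      using assms j by (simp add: length_level_list)
    fix i assume "i < length A"
    moreover have "(\<Prod>i<k. real (A ! i)) = real (level_value g n k j) / real g"
      using le F eq by linarith
    ultimately show "A ! i = level_list g n j ! i"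
      using prod_\<alpha>_le(2)[OF j(2,1) assms(7), of i] assms(2)
      by (simp only: level_value_def nth_level_list)
  qed
  then show ?thesis using j le F by (intro exI[of _ j]) auto
qed

section \<open>Comparison of the levels\<close>

lemma Suc_power_less:
  fixes l p :: nat
  assumes "2 \<le> l" "l < p" "p \<le> l + 2"
  shows "Suc p ^ Suc l < 2 ^ Suc l * p ^ l"
proof (cases "l \<le> 3")
  case True
  then have "l = 2 \<or> l = 3" "p = l + 1 \<or> p = l + 2" using assms by auto
  then show ?thesis by (elim disjE) (simp_all add: power_numeral_reduce)
next
  case False
  then have "4 \<le> l" by simp
  \<comment> \<open>The factor 3 bounds e, and p + 1 \<le> l + 3. This first holds at l = 4, hence
    the separate computation for l = 2 and l = 3.\<close>
  then have pow: "3 * (l + 3) < 2 ^ Suc l"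
    by (induction l rule: dec_induct) auto
  have "(1 + 1 / real p) ^ l \<le> exp (1 / real p) ^ l"
    by (intro power_mono exp_ge_add_one_self) auto
  also have "\<dots> = exp (real l / real p)" by (simp add: exp_of_nat_mult[symmetric])
  also have "\<dots> \<le> exp 1" using assms by simp
  also have "\<dots> \<le> 3" by (rule exp_le)
  finally have "(1 + 1 / real p) ^ l * real p ^ l \<le> 3 * real p ^ l"
    by (intro mult_right_mono) auto
  moreover have "(1 + 1 / real p) * real p = real (Suc p)" using assms by (simp add: field_simps)
  ultimately have "real (Suc p) ^ l \<le> 3 * real p ^ l"
    by (simp only: power_mult_distrib[symmetric])
  then have "real (Suc p ^ l) \<le> real (3 * p ^ l)"
    by (simp only: of_nat_mult of_nat_power of_nat_numeral)
  then have "Suc p ^ l \<le> 3 * p ^ l" by (simp only: of_nat_le_iff)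
  then have "Suc p ^ Suc l \<le> (3 * Suc p) * p ^ l"
    using mult_le_mono2[of "Suc p ^ l" "3 * p ^ l" "Suc p"] by (simp only: power_Suc mult_ac)
  also have "\<dots> < 2 ^ Suc l * p ^ l"
    using pow assms by (intro mult_strict_right_mono) auto
  finally show ?thesis .
qed

lemma two_power_mult_le: "2 ^ Suc l * t \<le> Suc t ^ Suc l" if "1 \<le> l" "1 \<le> t" for t :: nat
  using that(1)
proof (induction l rule: dec_induct)
  case base
  have "(int t - 1)\<^sup>2 \<ge> 0" by simp
  then have "int (4 * t) \<le> int (Suc t ^ 2)" by (simp add: power2_eq_square algebra_simps)
  then show ?case by (simp add: power2_eq_square del: of_nat_mult of_nat_power of_nat_Suc)
next
  case (step l)
  have "2 * (2 ^ Suc l * t) \<le> Suc t * Suc t ^ Suc l"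
    using step that(2) by (intro mult_le_mono) auto
  then show ?case by simp
qed

text \<open>With l = k - j - 1 and p = n - j - 1, cancelling t^(l+1) leaves t (p+1)^(l+1) against
  (t+1)^(l+1) p^l; the two preceding lemmas meet at 2^(l+1) t p^l. The range of j gives l \<ge> 2
  and leaves out the final pair of levels.\<close>

lemma level_value_less_Suc:
  assumes "1 \<le> g" "Suc (Suc j) < k" "k < n" "n \<le> k + 2"
  shows "level_value g n k j < level_value g n k (Suc j)"
proof -
  define t where "t = sylv_t g (Suc j)"
  define l where "l = k - Suc j"
  define p where "p = n - Suc j"
  have t: "1 \<le> t" using le_sylv_t[OF assms(1), of j] assms(1) by (simp add: t_def)
  have l: "2 \<le> l" "l < p" "p \<le> l + 2" using assms by (auto simp: l_def p_def)
  have eqs: "n - j = Suc p" "k - j = Suc l" using assms by (auto simp: l_def p_def)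
  have "t * Suc p ^ Suc l < t * (2 ^ Suc l * p ^ l)"
    using t Suc_power_less[OF l] by (intro mult_strict_left_mono) auto
  also have "\<dots> = (2 ^ Suc l * t) * p ^ l" by (simp add: mult_ac)
  also have "\<dots> \<le> Suc t ^ Suc l * p ^ l"
    using two_power_mult_le[of l t] l t by (intro mult_le_mono1) auto
  finally have "t ^ Suc l * (t * Suc p ^ Suc l) < t ^ Suc l * (Suc t ^ Suc l * p ^ l)"
    using t by (intro mult_strict_left_mono) auto
  moreover have "level_value g n k j = t ^ Suc l * (t * Suc p ^ Suc l)"
    unfolding level_value_def t_def[symmetric] eqs power_mult_distrib by (simp only: mult_ac)
  moreover have "level_value g n k (Suc j) = t ^ Suc l * (Suc t ^ Suc l * p ^ l)"
    unfolding level_value_def sylv_t_Suc t_def[symmetric] l_def[symmetric] p_def[symmetric] power_mult_distrib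
    by (simp only: power_Suc mult_ac)
  ultimately show ?thesis by simp
qed

lemma level_value_le:
  assumes "1 \<le> g" "k < n" "n \<le> k + 2" "j \<le> k - 2" "2 \<le> k"
  shows "level_value g n k j \<le> level_value g n k (k - 2)"
    and "level_value g n k j = level_value g n k (k - 2) \<Longrightarrow> j = k - 2"
proof -
  have "j = k - 2 \<or> level_value g n k j < level_value g n k (k - 2)"
    using assms(4)
  proof (induction j rule: inc_induct)
    case (step j)
    have "level_value g n k j < level_value g n k (Suc j)"
      using step.hyps assms by (intro level_value_less_Suc) auto
    then show ?case using step.IH by auto
  qed simp
  then show "level_value g n k j \<le> level_value g n k (k - 2)"
    "level_value g n k j = level_value g n k (k - 2) \<Longrightarrow> j = k - 2" by auto
qed

text \<open>Here m = n - k + 1 is the number of equal entries at level k - 1. Divided by t^2, the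
  values at levels k - 1 and k - 2 differ by (t - m) (t m - 1), so the sign of t - m
  decides.\<close>

lemma level_value_last2:
  assumes "1 \<le> g" "m \<in> {2, 3}" "n + 1 = k + m" "2 \<le> k"
  defines "t \<equiv> sylv_t g (k - 1)"
  shows "t < m \<Longrightarrow> level_value g n k (k - 1) < level_value g n k (k - 2)"
    and "t = m \<Longrightarrow> level_value g n k (k - 1) = level_value g n k (k - 2)"
    and "m < t \<Longrightarrow> level_value g n k (k - 2) < level_value g n k (k - 1)"
proof -
  define q where "q = k - 2"
  have q: "k = Suc (Suc q)" using assms(4) unfolding q_def by arith
  have n: "n = Suc q + m" using assms(3) q by simp
  have t: "t = sylv_t g (Suc q)" by (simp add: t_def q)
  have t1: "1 \<le> t" using le_sylv_t[OF assms(1), of q] assms(1) unfolding t by linarith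
  have v2: "level_value g n k (k - 2) = t\<^sup>2 * (t * (m + 1)\<^sup>2)"
  proof -
    have "n - (k - 2) = m + 1" "k - (k - 2) = 2" "Suc (k - 2) = Suc q"
      using n q by simp_all
    then have "level_value g n k (k - 2) = t * ((m + 1) * t)\<^sup>2"
      by (simp only: level_value_def t)
    then show ?thesis by (simp only: power2_eq_square mult_ac)
  qed
  have v1: "level_value g n k (k - 1) = t\<^sup>2 * (m * (t + 1)\<^sup>2)"
  proof -
    have "n - (k - 1) = m" "k - (k - 1) = 1" "Suc (k - 1) = Suc (Suc q)"
      using n q by simp_all
    then have "level_value g n k (k - 1) = (t * Suc t) * (m * (t * Suc t))"
      by (simp only: level_value_def sylv_t_Suc t power_one_right)
    then show ?thesis by (simp only: power2_eq_square mult_ac Suc_eq_plus1)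
  qed
  have fac: "int (m * (t + 1)\<^sup>2) - int (t * (m + 1)\<^sup>2) = (int t - int m) * (int t * int m - 1)"
    by (simp add: power2_eq_square algebra_simps)
  have "2 * 1 \<le> m * t" using assms(2) t1 by (intro mult_le_mono) auto
  then have tm: "0 < int t * int m - 1" by (simp add: mult.commute flip: of_nat_mult)
  {
    assume "t < m"
    then have "(int t - int m) * (int t * int m - 1) < 0" using tm by (intro mult_neg_pos) auto
    then have "m * (t + 1)\<^sup>2 < t * (m + 1)\<^sup>2" using fac by linarith
    then show "level_value g n k (k - 1) < level_value g n k (k - 2)"
      unfolding v1 v2 using t1 by (intro mult_strict_left_mono) auto
  next
    assume "t = m"
    then show "level_value g n k (k - 1) = level_value g n k (k - 2)" unfolding v1 v2 by simp
  next
    assume "m < t"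
    then have "0 < (int t - int m) * (int t * int m - 1)" using tm by (intro mult_pos_pos) auto
    then have "t * (m + 1)\<^sup>2 < m * (t + 1)\<^sup>2" using fac by linarith
    then show "level_value g n k (k - 2) < level_value g n k (k - 1)"
      unfolding v1 v2 using t1 by (intro mult_strict_left_mono) auto
  }
qed

section \<open>The maximum over all levels\<close>

text \<open>M is the largest level value and J the set of levels attaining it. Equality forces the
  level found for A into J; conversely \<open>Fk_level_list\<close> shows that every level in J
  attains the bound.\<close>

lemma Fk_le_maximum:
  fixes g n :: nat and A :: "nat list"
  assumes A: "1 \<le> g" "length A = n" "\<forall>a\<in>set A. a > 0" "sorted A"
    "(\<Sum>a\<leftarrow>A. 1 / real a) = 1 / real g" "1 \<le> k" "k \<le> n"
    and max: "\<And>j. j < k \<Longrightarrow> level_value g n k j \<le> M"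
      "\<And>j. j < k \<Longrightarrow> level_value g n k j = M \<longleftrightarrow> j \<in> J" "J \<subseteq> {..<k}"
  shows "Fk k A \<le> real M / real g \<and>
    (Fk k A = real M / real g \<longleftrightarrow> (\<exists>j\<in>J. A = level_list g n j))"
proof -
  obtain j where j: "j < k" "Fk k A \<le> real (level_value g n k j) / real g"
    "Fk k A = real (level_value g n k j) / real g \<Longrightarrow> A = level_list g n j"
    using Fk_le_level_value[OF A] by blast
  have le: "real (level_value g n k j) / real g \<le> real M / real g"
    using max(1)[OF j(1)] by (simp add: divide_right_mono)
  have "\<exists>j\<in>J. A = level_list g n j" if eq: "Fk k A = real M / real g"
  proof -
    have lv: "real (level_value g n k j) / real g = real M / real g"
      using j(2) le eq by linarith
    then have "j \<in> J" using max(2)[OF j(1)] A(1) by simp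
    then show ?thesis using j(3) eq lv by auto
  qed
  moreover have "Fk k A = real M / real g" if "i \<in> J" "A = level_list g n i" for i
    using that max(2)[of i] max(3) Fk_level_list[of g i k n] A(1,7) by auto
  ultimately show ?thesis using j(2) le by auto
qed

text \<open>The condition 2 \<le> k excludes the junk value of \<open>sylv_t g (k - 1)\<close> at k = 1.\<close>

lemma Fk_le_small_defect:
  fixes g n :: nat and A :: "nat list"
  assumes A: "1 \<le> g" "length A = n" "\<forall>a\<in>set A. a > 0" "sorted A"
    "(\<Sum>a\<leftarrow>A. 1 / real a) = 1 / real g" "1 \<le> k"
    and m: "m \<in> {2, 3}" "n + 1 = k + m"
  shows "2 \<le> k \<Longrightarrow> sylv_t g (k - 1) < m \<Longrightarrow>
      Fk k A \<le> real (level_value g n k (k - 2)) / real g \<and>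
      (Fk k A = real (level_value g n k (k - 2)) / real g \<longleftrightarrow> A = level_list g n (k - 2))"
    and "\<not> (2 \<le> k \<and> sylv_t g (k - 1) < m) \<Longrightarrow>
      Fk k A \<le> real m * real (sylv_t g k) ^ 2 / real g \<and>
      (Fk k A = real m * real (sylv_t g k) ^ 2 / real g \<longleftrightarrow>
        (2 \<le> k \<and> sylv_t g (k - 1) = m \<and> A = level_list g n (k - 2)) \<or> A = level_list g n (k - 1))"
proof -
  have kn: "k < n" "n \<le> k + 2" using m by auto
  note bound = Fk_le_maximum[OF A less_imp_le[OF kn(1)]]
  note last2 = level_value_last2[OF A(1) m]
  note le2 = level_value_le[OF A(1) kn]
  {
    assume k: "2 \<le> k" and t: "sylv_t g (k - 1) < m"
    note lt = last2(1)[OF k t]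
    have cases: "j \<le> k - 2 \<or> j = k - 1" if "j < k" for j
      using that by linarith
    have "level_value g n k j \<le> level_value g n k (k - 2)" if "j < k" for j
      using cases[OF that] le2(1)[of j] lt k by auto
    moreover have "level_value g n k j = level_value g n k (k - 2) \<longleftrightarrow> j \<in> {k - 2}" if "j < k" for j
      using cases[OF that] le2(2)[of j] lt k by auto
    ultimately show "Fk k A \<le> real (level_value g n k (k - 2)) / real g \<and>
        (Fk k A = real (level_value g n k (k - 2)) / real g \<longleftrightarrow> A = level_list g n (k - 2))"
      using bound[of "level_value g n k (k - 2)" "{k - 2}"] k by simp
  next
    assume ne: "\<not> (2 \<le> k \<and> sylv_t g (k - 1) < m)"
    define M where "M = level_value g n k (k - 1)"
    \<comment> \<open>Level k - 2 ties with level k - 1 exactly when t_(k-1) = m; the sporadic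
      extremal lists arise from these ties.\<close>
    define J where "J = {j. j = k - 1 \<or> 2 \<le> k \<and> sylv_t g (k - 1) = m \<and> j = k - 2}"
    have M: "real M = real m * real (sylv_t g k) ^ 2"
    proof -
      have "n - (k - 1) = m" "k - (k - 1) = 1" "Suc (k - 1) = k"
        using m A(6) by auto
      then show ?thesis by (simp add: M_def level_value_def power2_eq_square)
    qed
    have *: "level_value g n k j \<le> M \<and> (level_value g n k j = M \<longleftrightarrow> j \<in> J)" if "j < k" for j
    proof (cases "j = k - 1")
      case False
      then have k: "2 \<le> k" and j: "j \<le> k - 2" using that by linarith+
      have "sylv_t g (k - 1) = m \<or> m < sylv_t g (k - 1)" using ne k by linarith
      then show ?thesis
      proof
        assume t: "sylv_t g (k - 1) = m"
        show ?thesis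
          using last2(2)[OF k t] le2[OF j k] False t k by (auto simp: M_def J_def)
      next
        assume t: "m < sylv_t g (k - 1)"
        show ?thesis
          using last2(3)[OF k t] le2(1)[OF j k] False t by (auto simp: M_def J_def)
      qed
    qed (simp add: M_def J_def)
    have "J \<subseteq> {..<k}" using A(6) by (auto simp: J_def)
    then have "Fk k A \<le> real M / real g \<and>
        (Fk k A = real M / real g \<longleftrightarrow> (\<exists>j\<in>J. A = level_list g n j))"
      using * by (intro bound) auto
    then show "Fk k A \<le> real m * real (sylv_t g k) ^ 2 / real g \<and>
      (Fk k A = real m * real (sylv_t g k) ^ 2 / real g \<longleftrightarrow>
        (2 \<le> k \<and> sylv_t g (k - 1) = m \<and> A = level_list g n (k - 2)) \<or> A = level_list g n (k - 1))"
      unfolding M J_def by auto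
  }
qed

section \<open>Small Sylvester numbers and the exceptional cases\<close>

lemma sylv_t_2: "sylv_t g 2 = g * (g + 1)"
  using sylv_t_Suc[of g 0] by (simp add: sylv_t_1 numeral_2_eq_2)

text \<open>Once t \<ge> 2, the next term t (t + 1) is at least 6. So apart from t_1 = g only 1 * 2
  stays below 6, which locates all ties and exceptions.\<close>

lemma sylv_t_less_6:
  assumes "1 \<le> g" "1 \<le> i" "sylv_t g i < 6"
  shows "i = 1 \<and> sylv_t g i = g \<or> i = 2 \<and> g = 1 \<and> sylv_t g i = 2"
proof -
  have large: "6 \<le> t * Suc t" if "2 \<le> t" for t :: nat
    using mult_le_mono[OF that, of 3 "Suc t"] that by simp
  consider "i = 1" | j where "i = Suc (Suc j)" using assms(2) by (metis One_nat_def Suc_le_D not0_implies_Suc)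
  then show ?thesis
  proof cases
    case 2
    have "\<not> 2 \<le> sylv_t g (Suc j)"
      using large[of "sylv_t g (Suc j)"] assms(3) unfolding 2 sylv_t_Suc by linarith
    then have "g + j < 2" using le_sylv_t[OF assms(1), of j] by linarith
    then have "j = 0 \<and> g = 1" using assms(1) by linarith
    then show ?thesis using 2 sylv_t_2[of g] by (simp add: numeral_2_eq_2)
  qed (simp add: sylv_t_1)
qed

theorem theorem3p2:
  fixes g n :: nat and A :: "nat list"
  assumes hg: "g \<ge> 1" and hn: "n \<ge> 3" and hlen: "length A = n"
    and hpos: "\<forall>a\<in>set A. a > 0" and hsort: "sorted A"
    and hsum: "(\<Sum>a\<leftarrow>A. 1 / real a) = 1 / real g"
  shows
    "(Fk n A \<le> real (sylv_t g n) ^ 2 / real g \<and>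
      (Fk n A = real (sylv_t g n) ^ 2 / real g \<longleftrightarrow>
         A = map (sylv_s g) [1..<n] @ [sylv_t g n]))
   \<and> ((n = 3 \<and> g = 1 \<longrightarrow>
         Fk 2 A \<le> 9 \<and> (Fk 2 A = 9 \<longleftrightarrow> A = [3,3,3]))
      \<and> (\<not> (n = 3 \<and> g = 1) \<longrightarrow>
         Fk (n - 1) A \<le> 2 * real (sylv_t g (n - 1)) ^ 2 / real g \<and>
         (Fk (n - 1) A = 2 * real (sylv_t g (n - 1)) ^ 2 / real g \<longleftrightarrow>
           A = [6,6,6] \<or> A = [2,6,6,6] \<or>
           A = map (sylv_s g) [1..<n - 1] @
               [2 * sylv_t g (n - 1), 2 * sylv_t g (n - 1)])))
   \<and> ((n = 4 \<and> g \<in> {1,2} \<longrightarrow>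
         Fk 2 A \<le> 16 * real g ^ 2 \<and>
         (Fk 2 A = 16 * real g ^ 2 \<longleftrightarrow> A = [4*g, 4*g, 4*g, 4*g]))
      \<and> (n = 5 \<and> g = 1 \<longrightarrow>
         Fk 3 A \<le> 128 \<and> (Fk 3 A = 128 \<longleftrightarrow> A = [2,8,8,8,8]))
      \<and> (\<not> (n = 4 \<and> g \<in> {1,2}) \<and> \<not> (n = 5 \<and> g = 1) \<longrightarrow>
         Fk (n - 2) A \<le> 3 * real (sylv_t g (n - 2)) ^ 2 / real g \<and>
         (Fk (n - 2) A = 3 * real (sylv_t g (n - 2)) ^ 2 / real g \<longleftrightarrow>
           A = [12,12,12,12] \<or>
           A = map (sylv_s g) [1..<n - 2] @
               [3 * sylv_t g (n - 2), 3 * sylv_t g (n - 2), 3 * sylv_t g (n - 2)])))"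
proof -
  note A = hg hlen hpos hsort hsum
  have lists: "level_list g n (n - 1) = map (sylv_s g) [1..<n] @ [sylv_t g n]" (is ?full)
    "level_list g n (n - 2) = map (sylv_s g) [1..<n - 1] @
       [2 * sylv_t g (n - 1), 2 * sylv_t g (n - 1)]" (is ?defect1)
    "level_list g n (n - 3) = map (sylv_s g) [1..<n - 2] @
       [3 * sylv_t g (n - 2), 3 * sylv_t g (n - 2), 3 * sylv_t g (n - 2)]" (is ?defect2)
  proof -
    have "n - (n - 1) = 1" "n - (n - 2) = 2" "n - (n - 3) = 3"
      "Suc (n - 1) = n" "Suc (n - 2) = n - 1" "Suc (n - 3) = n - 2" using hn by auto
    then show ?full ?defect1 ?defect2
      unfolding level_list_def by (simp_all add: numeral_eq_Suc del: upt_Suc)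
  qed
  have first: "level_list g n 0 = replicate n (n * g)" for g n
    by (simp add: level_list_def sylv_t_1)
  have second: "level_list 1 n 1 = 2 # replicate (n - 1) ((n - 1) * 2)" for n
    using sylv_t_2[of 1] by (simp add: level_list_def sylv_s_def numeral_2_eq_2)
  have value0: "level_value g n k 0 = g * (n * g) ^ k" for g n k
    by (simp add: level_value_def sylv_t_1)
  have value1: "level_value 1 n k 1 = 2 * ((n - 1) * 2) ^ (k - 1)" for n k
    using sylv_t_2[of 1] by (simp add: level_value_def numeral_2_eq_2)

  have part1: "Fk n A \<le> real (sylv_t g n) ^ 2 / real g \<and>
      (Fk n A = real (sylv_t g n) ^ 2 / real g \<longleftrightarrow> A = level_list g n (n - 1))"
  proof -
    have v: "real (level_value g n n (n - 1)) = real (sylv_t g n) ^ 2"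
      using hn by (simp add: level_value_def power2_eq_square)
    \<comment> \<open>With k = n the level is fixed, so no comparison of levels enters.\<close>
    have "\<exists>j. j = n - 1 \<and> Fk n A \<le> real (level_value g n n j) / real g \<and>
        (Fk n A = real (level_value g n n j) / real g \<longrightarrow> A = level_list g n j)"
      using Fk_le_level_value[OF A, of n] hn by fastforce
    moreover have "Fk n (level_list g n (n - 1)) = real (sylv_t g n) ^ 2 / real g"
      using Fk_level_list[OF hg, of "n - 1" n n] hn unfolding v by simp
    ultimately show ?thesis unfolding ex_simps v by (metis v)
  qed

  have n1: "1 \<le> n - 1" "2 \<le> n - 1" "n + 1 = n - 1 + 2" "n - 1 - 1 = n - 2" "n - 1 - 2 = n - 3"
    using hn by auto
  have n2: "1 \<le> n - 2" "n + 1 = n - 2 + 3" "n - 2 - 1 = n - 3" "n - 2 - 2 = n - 4"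
    using hn by auto
  note defect1 = Fk_le_small_defect[OF A n1(1), of 2, OF _ n1(3), unfolded n1(4,5), simplified]
  note defect2 = Fk_le_small_defect[OF A n2(1), of 3, OF _ n2(2), unfolded n2(3,4), simplified]
  have "n - 2 = 1 \<longleftrightarrow> n = 3" "n - 2 = 2 \<longleftrightarrow> n = 4" using hn by auto
  then have small1: "sylv_t g (n - 2) < 6 \<Longrightarrow>
      n = 3 \<and> sylv_t g (n - 2) = g \<or> n = 4 \<and> g = 1 \<and> sylv_t g (n - 2) = 2"
    using sylv_t_less_6[OF hg n2(1)] by simp
  have "n - 3 = 1 \<longleftrightarrow> n = 4" "n - 3 = 2 \<longleftrightarrow> n = 5" by auto
  \<comment> \<open>The guard 2 \<le> n - 2 matters: at n = 3 the index n - 3 is 0, where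
    \<open>sylv_t g 0\<close> evaluates to the meaningless value g.\<close>
  then have small2: "2 \<le> n - 2 \<Longrightarrow> sylv_t g (n - 3) < 6 \<Longrightarrow>
      n = 4 \<and> sylv_t g (n - 3) = g \<or> n = 5 \<and> g = 1 \<and> sylv_t g (n - 3) = 2"
    using sylv_t_less_6[OF hg, of "n - 3"] by simp

  \<comment> \<open>Length and reciprocal sum of a sporadic list determine n and g, so the theorem
    can name these lists without conditions on n and g.\<close>
  have A666: "n = 3 \<and> g = 2" if "A = [6,6,6]" using that hlen hsum by simp
  have A2666: "n = 4 \<and> g = 1" if "A = [2,6,6,6]" using that hlen hsum by simp
  have A12: "n = 4 \<and> g = 3" if "A = [12,12,12,12]" using that hlen hsum by simp

  have part2a: "Fk 2 A \<le> 9 \<and> (Fk 2 A = 9 \<longleftrightarrow> A = [3,3,3])" if "n = 3 \<and> g = 1"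
  proof -
    have "real (level_value g n 2 0) / real g = 9" using that by (simp add: value0)
    moreover have "level_list g n 0 = [3,3,3]"
      using that by (simp add: first numeral_eq_Suc)
    moreover have "sylv_t g (n - 2) < 2" using that by (simp add: sylv_t_1)
    ultimately show ?thesis using defect1(1) that by simp
  qed
  have part2b: "Fk (n - 1) A \<le> 2 * real (sylv_t g (n - 1)) ^ 2 / real g \<and>
      (Fk (n - 1) A = 2 * real (sylv_t g (n - 1)) ^ 2 / real g \<longleftrightarrow>
        A = [6,6,6] \<or> A = [2,6,6,6] \<or> A = level_list g n (n - 2))" if "\<not> (n = 3 \<and> g = 1)"
  proof -
    have "\<not> sylv_t g (n - 2) < 2" using small1 that hg by (cases "sylv_t g (n - 2) < 6") linarith+
    \<comment> \<open>The tie t_(n-2) = 2 occurs for (n,g) = (3,2) at level 0 and for (4,1) at level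
      1.\<close>
    moreover have "sylv_t g (n - 2) = 2 \<and> A = level_list g n (n - 3) \<longleftrightarrow> A = [6,6,6] \<or> A = [2,6,6,6]"
    proof
      assume *: "sylv_t g (n - 2) = 2 \<and> A = level_list g n (n - 3)"
      then have "n = 3 \<and> g = 2 \<or> n = 4 \<and> g = 1" using small1 by auto
      then show "A = [6,6,6] \<or> A = [2,6,6,6]"
        using * first[of 2 3] second[of 4] by (auto simp: numeral_eq_Suc)
    next
      assume "A = [6,6,6] \<or> A = [2,6,6,6]"
      then show "sylv_t g (n - 2) = 2 \<and> A = level_list g n (n - 3)"
        using A666 A2666 first[of 2 3] second[of 4] sylv_t_1[of 2] sylv_t_2[of 1]
        by (auto simp: numeral_eq_Suc)
    qed
    ultimately show ?thesis using defect1(2) n1(2) by auto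
  qed

  have part3a: "Fk 2 A \<le> 16 * real g ^ 2 \<and> (Fk 2 A = 16 * real g ^ 2 \<longleftrightarrow> A = [4*g, 4*g, 4*g, 4*g])"
    if "n = 4 \<and> g \<in> {1,2}"
  proof -
    have "real (level_value g n 2 0) / real g = 16 * real g ^ 2"
      using that hg by (simp add: value0 power2_eq_square)
    moreover have "level_list g n 0 = [4*g, 4*g, 4*g, 4*g]"
      using that by (simp add: first numeral_eq_Suc)
    moreover have "sylv_t g (n - 3) < 3" using that by (auto simp: sylv_t_1)
    ultimately show ?thesis using defect2(1) that by simp
  qed
  have part3b: "Fk 3 A \<le> 128 \<and> (Fk 3 A = 128 \<longleftrightarrow> A = [2,8,8,8,8])" if "n = 5 \<and> g = 1"
  proof -
    have "real (level_value g n 3 1) / real g = 128"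
      using that value1[of 5 3] by simp
    moreover have "level_list g n 1 = [2,8,8,8,8]"
      using that second[of 5] by (simp add: numeral_eq_Suc)
    moreover have "sylv_t g (n - 3) < 3" using that sylv_t_2[of 1] by simp
    ultimately show ?thesis using defect2(1) that by simp
  qed
  have part3c: "Fk (n - 2) A \<le> 3 * real (sylv_t g (n - 2)) ^ 2 / real g \<and>
      (Fk (n - 2) A = 3 * real (sylv_t g (n - 2)) ^ 2 / real g \<longleftrightarrow>
        A = [12,12,12,12] \<or> A = level_list g n (n - 3))"
    if "\<not> (n = 4 \<and> g \<in> {1,2}) \<and> \<not> (n = 5 \<and> g = 1)"
  proof -
    \<comment> \<open>For n \<ge> 4, t_(n-3) < 3 occurs only in the excluded cases: g \<le> 2 with n
      = 4, or t_2 = 2 with n = 5 and g = 1.\<close>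
    have "\<not> (2 \<le> n - 2 \<and> sylv_t g (n - 3) < 3)"
    proof
      assume *: "2 \<le> n - 2 \<and> sylv_t g (n - 3) < 3"
      then have "n = 4 \<and> sylv_t g (n - 3) = g \<or> n = 5 \<and> g = 1" using small2 by auto
      then have "n = 4 \<and> (g = 1 \<or> g = 2) \<or> n = 5 \<and> g = 1" using * hg by linarith
      then show False using that by auto
    qed
    \<comment> \<open>A tie at 3 can only come from t_1 = g = 3, hence n = 4 and level 0.\<close>
    moreover have "2 \<le> n - 2 \<and> sylv_t g (n - 3) = 3 \<and> A = level_list g n (n - 4) \<longleftrightarrow> A = [12,12,12,12]"
    proof
      assume *: "2 \<le> n - 2 \<and> sylv_t g (n - 3) = 3 \<and> A = level_list g n (n - 4)"
      then have "n = 4 \<and> g = 3" using small2 by auto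
      then show "A = [12,12,12,12]"
        using * first[of 3 4] by (auto simp: numeral_eq_Suc)
    next
      assume "A = [12,12,12,12]"
      then show "2 \<le> n - 2 \<and> sylv_t g (n - 3) = 3 \<and> A = level_list g n (n - 4)"
        using A12 first[of 3 4] sylv_t_1[of 3] by (auto simp: numeral_eq_Suc)
    qed
    ultimately show ?thesis using defect2(2) by auto
  qed
  show ?thesis
    by (rule conjI[OF part1[unfolded lists]
          conjI[OF conjI[OF impI[OF part2a] impI[OF part2b[unfolded lists]]]
            conjI[OF impI[OF part3a] conjI[OF impI[OF part3b] impI[OF part3c[unfolded lists]]]]]])
qed

end
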